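(* Let $X$ be a finite dataset, and fix a collection of bins $\mathbb{B}$ of $X$ and $\epsilon\in\mathbb{R}$. Let $\{MinPts_i\}$ be a family of positive integers, and for each $i$ let DBSCAN with parameters $\epsilon$ and $MinPts_i$ be used to cluster each bin of $\mathbb{B}$, giving the cluster cover $\mathbb{C}_{MinPts_i}$. If for all $j$ no free-border points exist with respect to $\epsilon$ and $MinPts_j$ (in any bin of $\mathbb{B}$), then there is a filtration of cluster covers $$\{c^{MinPts_i,MinPts_j}:\mathbb{C}_{MinPts_i}\to\mathbb{C}_{MinPts_j},\ \forall\,MinPts_i\ge MinPts_j\}.$$
   Context: DBSCAN. Let $Y$ be a finite (ordered) set of points in a metric space, $\epsilon\in\mathbb{R}$, $MinPts$ a positive integer, and $N_\epsilon(p)=\{q\in Y: dist(p,q)\le\epsilon\}$ for $p\in Y$. A point $p\in Y$ is a core point if $|N_\epsilon(p)|\ge MinPts$; a border point if it is not core but lies in $N_\epsilon(p')$ for some core point $p'$; and noise otherwise. A point $q$ is directly density-reachable from $p$ if $p$ is core and $q\in N_\epsilon(p)$. A point $q$ is density-reachable from $p$ if there are points $p=\alpha_1,\dots,\alpha_n=q$ in $Y$, $n\ge 2$, with each $\alpha_{i+1}$ directly density-reachable from $\alpha_i$. Points $p,q$ are density-connected if there is a point $o\in Y$ from which both are density-reachable. DBSCAN outputs a partition $Y=C_1\sqcup\dots\sqcup C_n\sqcup N$, with $N$ the set of noise points and the clusters $C_i$, each containing at least one core point, satisfying: (Maximality) if $p\in C_i$, $q\notin \bigsqcup_{j<i}C_j$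 and $q$ is density-reachable from $p$, then $q\in C_i$; (Connectivity) any $p,q\in C_i$ are density-connected. The assignment of some border points may depend on the ordering of $Y$. A point $s\in Y$ is a free-border point with respect to $\epsilon$ and $MinPts$ if $|N_\epsilon(s)|<MinPts$ and there are core points $p,q\in Y$ with $s\in N_\epsilon(p)$, $s\in N_\epsilon(q)$ and $p$ not density-connected to $q$. Bins and cluster covers. A bin is a subset of $X$; $\mathbb{B}$ is a finite indexed collection of bins covering $X$. DBSCAN is run separately inside each bin (with $Y$ = the bin). The cluster cover is the family of all clusters so obtained, indexed by the bin they come from (clusters in different bins are different elements even if equal as sets); noise points belong to no cluster, and the word "cover" is used regardless. Filtration of cluster covers. A family $\{\mathbb{U}_\lambda\}$ indexed by a partially ordered parameter set is a filtration if it has maps $u^{\lambda,\mu}:\mathbb{U}_\lambda\to\mathbb{U}_\mu$ for $\lambda\le\mu$ such that $u^{\lambda,\mu}(U)=V$ implies $U\subseteq V$, and $u^{\mu,\nu}\circ u^{\lambda,\mu}=u^{\lambda,\nu}$ for $\lambda\le\mu\le\nu$. Here the parameter is $MinPts$ with the reversed order, so maps go from larger to smaller $MinPts$. *)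

theory Defs
  imports Complex_Main "HOL-Library.Disjoint_Sets" "HOL-Library.FuncSet"
begin

definition eps_nbhd :: "'a::metric_space set \<Rightarrow> real \<Rightarrow> 'a \<Rightarrow> 'a set" where
  "eps_nbhd Y \<epsilon> p = {q \<in> Y. dist p q \<le> \<epsilon>}"

definition core_point :: "'a::metric_space set \<Rightarrow> real \<Rightarrow> nat \<Rightarrow> 'a \<Rightarrow> bool" where
  "core_point Y \<epsilon> m p \<longleftrightarrow> p \<in> Y \<and> card (eps_nbhd Y \<epsilon> p) \<ge> m"

definition border_point :: "'a::metric_space set \<Rightarrow> real \<Rightarrow> nat \<Rightarrow> 'a \<Rightarrow> bool" where
  "border_point Y \<epsilon> m p \<longleftrightarrow>
     p \<in> Y \<and> \<not> core_point Y \<epsilon> m p \<and> (\<exists>p'. core_point Y \<epsilon> m p' \<and> p \<in> eps_nbhd Y \<epsilon> p')"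

definition noise_point :: "'a::metric_space set \<Rightarrow> real \<Rightarrow> nat \<Rightarrow> 'a \<Rightarrow> bool" where
  "noise_point Y \<epsilon> m p \<longleftrightarrow>
     p \<in> Y \<and> \<not> core_point Y \<epsilon> m p \<and> \<not> border_point Y \<epsilon> m p"

text \<open>In the next two definitions \<open>q\<close>, the last argument, is the point reached from \<open>p\<close>.\<close>

definition directly_density_reachable ::
    "'a::metric_space set \<Rightarrow> real \<Rightarrow> nat \<Rightarrow> 'a \<Rightarrow> 'a \<Rightarrow> bool" where
  "directly_density_reachable Y \<epsilon> m p q \<longleftrightarrow> core_point Y \<epsilon> m p \<and> q \<in> eps_nbhd Y \<epsilon> p"

text \<open>Chains have at least two points, i.e. at least one step, so this is the
  transitive closure and not the reflexive-transitive one. All points of a chain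
  lie in \<open>Y\<close>, since a direct step relates points of \<open>Y\<close> only.\<close>

definition density_reachable ::
    "'a::metric_space set \<Rightarrow> real \<Rightarrow> nat \<Rightarrow> 'a \<Rightarrow> 'a \<Rightarrow> bool" where
  "density_reachable Y \<epsilon> m = (directly_density_reachable Y \<epsilon> m)\<^sup>+\<^sup>+"

definition density_connected ::
    "'a::metric_space set \<Rightarrow> real \<Rightarrow> nat \<Rightarrow> 'a \<Rightarrow> 'a \<Rightarrow> bool" where
  "density_connected Y \<epsilon> m p q \<longleftrightarrow>
     (\<exists>z\<in>Y. density_reachable Y \<epsilon> m z p \<and> density_reachable Y \<epsilon> m z q)"

definition free_border_point ::
    "'a::metric_space set \<Rightarrow> real \<Rightarrow> nat \<Rightarrow> 'a \<Rightarrow> bool" where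
  "free_border_point Y \<epsilon> m s \<longleftrightarrow>
     s \<in> Y \<and> card (eps_nbhd Y \<epsilon> s) < m \<and>
     (\<exists>p q. core_point Y \<epsilon> m p \<and> core_point Y \<epsilon> m q \<and>
        s \<in> eps_nbhd Y \<epsilon> p \<and> s \<in> eps_nbhd Y \<epsilon> q \<and> \<not> density_connected Y \<epsilon> m p q)"

text \<open>\<open>Cs\<close> lists the clusters in the order in which DBSCAN produces them. The point
  set \<open>Y\<close> is unordered here: the outputs for the various orderings of \<open>Y\<close> may differ,
  and the predicate is meant to hold of each of them.\<close>

definition dbscan_output ::
    "'a::metric_space set \<Rightarrow> real \<Rightarrow> nat \<Rightarrow> 'a set list \<Rightarrow> bool" where
  "dbscan_output Y \<epsilon> m Cs \<longleftrightarrow>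
     \<Union>(set Cs) \<union> {p. noise_point Y \<epsilon> m p} = Y \<and>
     \<Union>(set Cs) \<inter> {p. noise_point Y \<epsilon> m p} = {} \<and>
     disjoint_family_on ((!) Cs) {..<length Cs} \<and>
     (\<forall>C\<in>set Cs. \<exists>p\<in>C. core_point Y \<epsilon> m p) \<and>
     (\<forall>i<length Cs. \<forall>p q. p \<in> Cs ! i \<and> q \<notin> (\<Union>j<i. Cs ! j) \<and> density_reachable Y \<epsilon> m p q
        \<longrightarrow> q \<in> Cs ! i) \<and>
     (\<forall>C\<in>set Cs. \<forall>p\<in>C. \<forall>q\<in>C. density_connected Y \<epsilon> m p q)"

definition bin_collection :: "'a set \<Rightarrow> 'b set \<Rightarrow> ('b \<Rightarrow> 'a set) \<Rightarrow> bool" where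
  "bin_collection X J B \<longleftrightarrow> finite J \<and> (\<forall>b\<in>J. B b \<subseteq> X) \<and> (\<Union>b\<in>J. B b) = X"

text \<open>An element \<open>(b, C)\<close> is the cluster \<open>C\<close> of the bin with index \<open>b\<close>; the tag keeps
  clusters of different bins apart, and \<open>snd\<close> recovers the underlying point set.\<close>

definition cluster_cover :: "'b set \<Rightarrow> ('b \<Rightarrow> 'a set list) \<Rightarrow> ('b \<times> 'a set) set" where
  "cluster_cover J D = (SIGMA b:J. set (D b))"

text \<open>The parameter poset is the set \<open>L\<close> with order \<open>r\<close>; \<open>supp\<close> sends an element of a
  cover, possibly carrying a tag, to its underlying set.\<close>

definition is_filtration ::
    "'l set \<Rightarrow> 'l rel \<Rightarrow> ('l \<Rightarrow> 'c set) \<Rightarrow> ('c \<Rightarrow> 'a set) \<Rightarrow> ('l \<Rightarrow> 'l \<Rightarrow> 'c \<Rightarrow> 'c) \<Rightarrow> bool" where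
  "is_filtration L r \<U> supp u \<longleftrightarrow>
     partial_order_on L r \<and>
     (\<forall>(l, k)\<in>r. u l k \<in> \<U> l \<rightarrow> \<U> k \<and> (\<forall>U\<in>\<U> l. supp U \<subseteq> supp (u l k U))) \<and>
     (\<forall>l k n. (l, k) \<in> r \<and> (k, n) \<in> r \<longrightarrow> (\<forall>U\<in>\<U> l. u k n (u l k U) = u l n U))"

end

theory Submission
  imports Defs
begin

text \<open>
  The reason is that, in the absence of free-border points, a cluster holding a core point \<open>p\<close>
  is exactly the set of points density-reachable from \<open>p\<close>, and this set can only grow when
  \<open>MinPts\<close> decreases.

  One inclusion always holds: chains between core points can be reversed, so a point
  density-connected to \<open>p\<close> is density-reachable from \<open>p\<close>
  (\<open>density_reachable_if_connected\<close>). The other one may fail for a general DBSCAN output,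
  because a border point can be taken by an earlier cluster. Such a border point lies close to
  core points of two clusters, and without free-border points these core points are
  density-connected, so the two clusters would have to coincide
  (\<open>dbscan_cluster_closed_under_reachability\<close>).

  Lowering \<open>MinPts\<close> keeps core points core and chains valid, so every cluster for the larger
  value lies in a cluster for the smaller one (\<open>dbscan_cluster_mono\<close>). Clusters of one bin are
  disjoint and nonempty, so the containing cluster is unique. Sending each cluster to it is
  therefore a well-defined map, and uniqueness also gives the composition law.
\<close>

section \<open>Density reachability\<close>

lemma directly_density_reachable_mono:
  assumes "n \<le> m" "directly_density_reachable Y \<epsilon> m p q"
  shows "directly_density_reachable Y \<epsilon> n p q"
  using assms by (auto simp: directly_density_reachable_def core_point_def)

lemma density_reachable_mono:
  assumes "n \<le> m" "density_reachable Y \<epsilon> m p q"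
  shows "density_reachable Y \<epsilon> n p q"
  using assms(2) unfolding density_reachable_def
  by (induction rule: tranclp_induct)
     (blast intro: tranclp.intros directly_density_reachable_mono[OF assms(1)])+

lemma density_reachable_trans:
  assumes "density_reachable Y \<epsilon> m p q" "density_reachable Y \<epsilon> m q s"
  shows "density_reachable Y \<epsilon> m p s"
  using assms unfolding density_reachable_def by (rule tranclp_trans)

lemma density_reachable_last_step:
  assumes "density_reachable Y \<epsilon> m p q"
  obtains p' where "p' = p \<or> density_reachable Y \<epsilon> m p p'"
    and "directly_density_reachable Y \<epsilon> m p' q"
  using assms(1) unfolding density_reachable_def
proof (cases rule: tranclp.cases)
  case r_into_trancl
  then show thesis using that[of p] by simp
next
  case (trancl_into_trancl p')
  then show thesis using that[of p'] by (simp add: density_reachable_def)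
qed

text \<open>Every point of a chain except the last is core by definition; once the last one is core too,
  symmetry of the distance lets each step be traversed backwards.\<close>

lemma density_reachable_sym_if_core:
  assumes "density_reachable Y \<epsilon> m p q" "core_point Y \<epsilon> m q"
  shows "density_reachable Y \<epsilon> m q p"
  using assms unfolding density_reachable_def
proof (induction rule: tranclp_induct)
  case (base y)
  then have "directly_density_reachable Y \<epsilon> m y p"
    by (auto simp: directly_density_reachable_def core_point_def eps_nbhd_def dist_commute)
  then show ?case by (rule tranclp.r_into_trancl)
next
  case (step y z)
  then have "core_point Y \<epsilon> m y" "directly_density_reachable Y \<epsilon> m z y"
    by (auto simp: directly_density_reachable_def core_point_def eps_nbhd_def dist_commute)
  then show ?case using step.IH by (meson tranclp_into_tranclp2)
qed

lemma density_reachable_if_connected: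
  assumes "density_connected Y \<epsilon> m p q" "core_point Y \<epsilon> m p"
  shows "density_reachable Y \<epsilon> m p q"
proof -
  obtain z where z: "density_reachable Y \<epsilon> m z p" "density_reachable Y \<epsilon> m z q"
    using assms(1) unfolding density_connected_def by blast
  show ?thesis
    using density_reachable_trans[OF density_reachable_sym_if_core[OF z(1) assms(2)] z(2)] .
qed

section \<open>Clusters of a DBSCAN output\<close>

lemma dbscan_cluster_has_core:
  assumes "dbscan_output Y \<epsilon> m Cs" "C \<in> set Cs"
  obtains p where "p \<in> C" "core_point Y \<epsilon> m p"
proof -
  have "\<forall>C\<in>set Cs. \<exists>p\<in>C. core_point Y \<epsilon> m p"
    using assms(1) unfolding dbscan_output_def by (elim conjE)
  then show ?thesis using assms(2) that by blast
qed

lemma dbscan_index_unique: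
  assumes "dbscan_output Y \<epsilon> m Cs" "i < length Cs" "j < length Cs" "x \<in> Cs ! i" "x \<in> Cs ! j"
  shows "i = j"
proof -
  have "disjoint_family_on ((!) Cs) {..<length Cs}"
    using assms(1) unfolding dbscan_output_def by (elim conjE)
  then show ?thesis
    using assms(2-) unfolding disjoint_family_on_def by blast
qed

lemma dbscan_cluster_unique:
  assumes "dbscan_output Y \<epsilon> m Cs" "C \<in> set Cs" "C' \<in> set Cs" "x \<in> C" "x \<in> C'"
  shows "C = C'"
proof -
  obtain i j where "i < length Cs" "Cs ! i = C" "j < length Cs" "Cs ! j = C'"
    using assms(2,3) by (auto simp: in_set_conv_nth)
  then show ?thesis
    using dbscan_index_unique[OF assms(1), of i j x] assms(4,5) by blast
qed

lemma dbscan_core_reaches_cluster: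
  assumes "dbscan_output Y \<epsilon> m Cs" "C \<in> set Cs" "p \<in> C" "core_point Y \<epsilon> m p" "q \<in> C"
  shows "density_reachable Y \<epsilon> m p q"
proof -
  have "\<forall>C\<in>set Cs. \<forall>p\<in>C. \<forall>q\<in>C. density_connected Y \<epsilon> m p q"
    using assms(1) unfolding dbscan_output_def by (elim conjE)
  then have "density_connected Y \<epsilon> m p q"
    using assms(2,3,5) by blast
  then show ?thesis using assms(4) by (rule density_reachable_if_connected)
qed

lemma dbscan_core_in_cluster:
  assumes "dbscan_output Y \<epsilon> m Cs" "core_point Y \<epsilon> m p"
  obtains C where "C \<in> set Cs" "p \<in> C"
proof -
  have "p \<in> Y" "\<not> noise_point Y \<epsilon> m p"
    using assms(2) by (auto simp: core_point_def noise_point_def)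
  moreover have "\<Union>(set Cs) \<union> {p. noise_point Y \<epsilon> m p} = Y"
    using assms(1) unfolding dbscan_output_def by (elim conjE)
  ultimately show ?thesis using that by blast
qed

lemma dbscan_maximality:
  assumes "dbscan_output Y \<epsilon> m Cs" "i < length Cs" "p \<in> Cs ! i" "density_reachable Y \<epsilon> m p q"
    and "\<And>j. j < i \<Longrightarrow> q \<notin> Cs ! j"
  shows "q \<in> Cs ! i"
proof -
  have "\<forall>i<length Cs. \<forall>p q. p \<in> Cs ! i \<and> q \<notin> (\<Union>j<i. Cs ! j) \<and> density_reachable Y \<epsilon> m p q
          \<longrightarrow> q \<in> Cs ! i"
    using assms(1) unfolding dbscan_output_def by (elim conjE)
  then have "p \<in> Cs ! i \<and> q \<notin> (\<Union>j<i. Cs ! j) \<and> density_reachable Y \<epsilon> m p q \<longrightarrow> q \<in> Cs ! i"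
    using assms(2) by blast
  moreover have "q \<notin> (\<Union>j<i. Cs ! j)"
    using assms(5) by blast
  ultimately show ?thesis
    using assms(3,4) by blast
qed

text \<open>If a point is reachable from two core points, these reach each other: either the point is
  core and the chains can be reversed through it, or it is a border point shared by the last core
  points of the two chains, which are density-connected because the point is not free-border.\<close>

lemma core_points_reaching_common_point:
  assumes no_free: "\<not> (\<exists>s. free_border_point Y \<epsilon> m s)"
    and core: "core_point Y \<epsilon> m p" "core_point Y \<epsilon> m z"
    and reach: "density_reachable Y \<epsilon> m p q" "density_reachable Y \<epsilon> m z q"
  shows "density_reachable Y \<epsilon> m z p"
proof (cases "core_point Y \<epsilon> m q")
  case True
  then show ?thesis
    using reach by (blast intro: density_reachable_sym_if_core density_reachable_trans)
next
  case False
  obtain p' where p': "p' = p \<or> density_reachable Y \<epsilon> m p p'"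
      "directly_density_reachable Y \<epsilon> m p' q"
    using density_reachable_last_step[OF reach(1)] .
  obtain z' where z': "z' = z \<or> density_reachable Y \<epsilon> m z z'"
      "directly_density_reachable Y \<epsilon> m z' q"
    using density_reachable_last_step[OF reach(2)] .
  have core': "core_point Y \<epsilon> m p'" "core_point Y \<epsilon> m z'"
    and nbhd: "q \<in> eps_nbhd Y \<epsilon> p'" "q \<in> eps_nbhd Y \<epsilon> z'"
    using p'(2) z'(2) by (auto simp: directly_density_reachable_def)
  have "q \<in> Y" "card (eps_nbhd Y \<epsilon> q) < m"
    using nbhd False by (auto simp: core_point_def eps_nbhd_def)
  then have "density_connected Y \<epsilon> m z' p'"
    using no_free core' nbhd unfolding free_border_point_def by blast
  then have "density_reachable Y \<epsilon> m z' p'"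
    using core'(2) by (rule density_reachable_if_connected)
  moreover have "p' = p \<or> density_reachable Y \<epsilon> m p' p"
    using p'(1) core'(1) density_reachable_sym_if_core by blast
  ultimately show ?thesis
    using z'(1) by (blast intro: density_reachable_trans)
qed

text \<open>Maximality would put \<open>q\<close> into the cluster of \<open>p\<close> unless an earlier cluster took it first. In
  that case a core point of the earlier cluster reaches \<open>q\<close>, hence also \<open>p\<close>, and maximality of the
  earlier cluster forces \<open>p\<close> into it, against disjointness.\<close>

lemma dbscan_cluster_closed_under_reachability:
  assumes out: "dbscan_output Y \<epsilon> m Cs"
    and no_free: "\<not> (\<exists>s. free_border_point Y \<epsilon> m s)"
    and C: "C \<in> set Cs" "p \<in> C"
    and core: "core_point Y \<epsilon> m p"
    and reach: "density_reachable Y \<epsilon> m p q"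
  shows "q \<in> C"
proof -
  obtain i where i: "i < length Cs" "Cs ! i = C"
    using C(1) by (auto simp: in_set_conv_nth)
  have "q \<notin> Cs ! j" if "j < i" for j
  proof
    assume q: "q \<in> Cs ! j"
    have j: "j < length Cs" using that i(1) by simp
    obtain z where z: "z \<in> Cs ! j" "core_point Y \<epsilon> m z"
      using dbscan_cluster_has_core[OF out nth_mem[OF j]] .
    have "density_reachable Y \<epsilon> m z q"
      using dbscan_core_reaches_cluster[OF out nth_mem[OF j] z q] .
    then have "density_reachable Y \<epsilon> m z p"
      using core_points_reaching_common_point[OF no_free core z(2) reach] by blast
    moreover have "p \<notin> Cs ! k" if "k < j" for k
      using dbscan_index_unique[OF out, of i k p] i C(2) j \<open>j < i\<close> that by auto
    ultimately have "p \<in> Cs ! j"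
      using dbscan_maximality[OF out j z(1)] by blast
    then show False
      using dbscan_index_unique[OF out, of i j p] i C(2) j \<open>j < i\<close> by auto
  qed
  then show ?thesis
    using dbscan_maximality[OF out i(1) _ reach] i(2) C(2) by blast
qed

section \<open>Decreasing the density threshold\<close>

lemma dbscan_cluster_mono:
  assumes out: "dbscan_output Y \<epsilon> m Cs" "dbscan_output Y \<epsilon> n Cs'"
    and no_free: "\<not> (\<exists>s. free_border_point Y \<epsilon> n s)"
    and le: "n \<le> m" and C: "C \<in> set Cs"
  shows "\<exists>!C'. C' \<in> set Cs' \<and> C \<subseteq> C'"
proof -
  obtain p where p: "p \<in> C" "core_point Y \<epsilon> m p"
    using dbscan_cluster_has_core[OF out(1) C] .
  have core: "core_point Y \<epsilon> n p"
    using p(2) le by (auto simp: core_point_def)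
  obtain C' where C': "C' \<in> set Cs'" "p \<in> C'"
    using dbscan_core_in_cluster[OF out(2) core] .
  have "q \<in> C'" if "q \<in> C" for q
  proof -
    have "density_reachable Y \<epsilon> n p q"
      using density_reachable_mono[OF le dbscan_core_reaches_cluster[OF out(1) C p that]] .
    then show ?thesis
      using dbscan_cluster_closed_under_reachability[OF out(2) no_free C' core] by blast
  qed
  with C' show ?thesis
    using dbscan_cluster_unique[OF out(2)] p(1) by blast
qed

text \<open>Under unique containment the maps are determined by inclusion: the composite of two of them
  sends a cluster to some superset in the same bin, and the direct map has no other choice.\<close>

lemma is_filtration_if_unique_superset:
  fixes D :: "'l \<Rightarrow> 'b \<Rightarrow> 'a set list"
  assumes po: "partial_order_on L r"
    and unique: "\<And>m n b C. (m, n) \<in> r \<Longrightarrow> b \<in> J \<Longrightarrow> C \<in> set (D m b) \<Longrightarrow>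
                   \<exists>!C'. C' \<in> set (D n b) \<and> C \<subseteq> C'"
  shows "\<exists>c. is_filtration L r (\<lambda>m. cluster_cover J (D m)) snd c"
proof -
  define f where "f n b C = (THE C'. C' \<in> set (D n b) \<and> C \<subseteq> C')" for n b C
  define c where "c m n = (\<lambda>(b, C). (b, f n b C))" for m n :: 'l
  have f: "f n b C \<in> set (D n b)" "C \<subseteq> f n b C"
    if "(m, n) \<in> r" "b \<in> J" "C \<in> set (D m b)" for m n b C
    using theI'[OF unique[OF that]] unfolding f_def by blast+
  have f_eq: "f n b C = C'"
    if "(m, n) \<in> r" "b \<in> J" "C \<in> set (D m b)" "C' \<in> set (D n b)" "C \<subseteq> C'" for m n b C C'
    using unique[OF that(1-3)] f[OF that(1-3)] that(4,5) by blast
  have tr: "(l, n) \<in> r" if "(l, k) \<in> r" "(k, n) \<in> r" for l k n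
    using po that unfolding partial_order_on_def preorder_on_def by (meson transD)
  have comp: "f n b (f k b C) = f n b C"
    if r: "(l, k) \<in> r" "(k, n) \<in> r" and C: "b \<in> J" "C \<in> set (D l b)" for l k n b C
  proof -
    note fk = f[OF r(1) C]
    note fn = f[OF r(2) C(1) fk(1)]
    have "C \<subseteq> f n b (f k b C)" using fk(2) fn(2) by blast
    then show ?thesis
      using f_eq[OF tr[OF r] C fn(1)] by simp
  qed
  have maps: "c m n \<in> cluster_cover J (D m) \<rightarrow> cluster_cover J (D n)"
    if "(m, n) \<in> r" for m n
    using f[OF that] by (auto simp: cluster_cover_def c_def)
  have incl: "snd U \<subseteq> snd (c m n U)"
    if "(m, n) \<in> r" "U \<in> cluster_cover J (D m)" for m n U
    using f(2)[OF that(1)] that(2) by (fastforce simp: cluster_cover_def c_def)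
  have compat: "c k n (c l k U) = c l n U"
    if "(l, k) \<in> r" "(k, n) \<in> r" "U \<in> cluster_cover J (D l)" for l k n U
    using comp[OF that(1,2)] that(3) by (auto simp: cluster_cover_def c_def)
  show ?thesis
    unfolding is_filtration_def using po maps incl compat
    by (intro exI[of _ c]) fast
qed

theorem theorem5:
  fixes X :: "'a::metric_space set"
    and J :: "'b set" and B :: "'b \<Rightarrow> 'a set"
    and \<epsilon> :: real
    and I :: "'i set" and MinPts :: "'i \<Rightarrow> nat"
    and D :: "nat \<Rightarrow> 'b \<Rightarrow> 'a set list"
  assumes "finite X"
    and "bin_collection X J B"
    and "\<And>i. i \<in> I \<Longrightarrow> MinPts i > 0"
    and "\<And>i b. i \<in> I \<Longrightarrow> b \<in> J \<Longrightarrow> dbscan_output (B b) \<epsilon> (MinPts i) (D (MinPts i) b)"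
    and "\<And>j b. j \<in> I \<Longrightarrow> b \<in> J \<Longrightarrow> \<not> (\<exists>s. free_border_point (B b) \<epsilon> (MinPts j) s)"
  shows "\<exists>c. is_filtration (MinPts ` I)
               {(m, n). m \<in> MinPts ` I \<and> n \<in> MinPts ` I \<and> m \<ge> n}
               (\<lambda>m. cluster_cover J (D m)) snd c"
proof (rule is_filtration_if_unique_superset)
  show "partial_order_on (MinPts ` I)
          {(m, n). m \<in> MinPts ` I \<and> n \<in> MinPts ` I \<and> m \<ge> n}"
    unfolding partial_order_on_def preorder_on_def refl_on_def
    by (auto intro!: transI antisymI)
next
  fix m n b C
  assume "(m, n) \<in> {(m, n). m \<in> MinPts ` I \<and> n \<in> MinPts ` I \<and> m \<ge> n}"
    and b: "b \<in> J" and C: "C \<in> set (D m b)"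
  then obtain i j where i: "i \<in> I" "m = MinPts i" and j: "j \<in> I" "n = MinPts j" and le: "n \<le> m"
    by blast
  have "dbscan_output (B b) \<epsilon> m (D m b)" "dbscan_output (B b) \<epsilon> n (D n b)"
    using assms(4) b i j by simp_all
  moreover have "\<not> (\<exists>s. free_border_point (B b) \<epsilon> n s)"
    using assms(5)[OF j(1) b] j(2) by simp
  ultimately show "\<exists>!C'. C' \<in> set (D n b) \<and> C \<subseteq> C'"
    using dbscan_cluster_mono[OF _ _ _ le C] by blast
qed

end
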